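(* Let $X$ be a set, $E$ a set of parameters, and let $\boldsymbol{\Sigma}=\{\Sigma_e : e\in E\}$ be a family of crisp topologies on $X$ indexed by $E$. If $(X,\Sigma_e)$ is a $T_1$-space for some $e\in E$, then $\mathcal{T}(\boldsymbol{\Sigma})$ is a soft $T_1$-space.
   Context: A "crisp" topology is an ordinary topology. A soft set over $X$ (with parameter set $E$) is $(F,E)=\{(e,F(e)) : e\in E\}$ where $F:E\to\mathcal{P}(X)$ is a map; $S_E(X)$ is the family of all soft sets. For $x\in X$, $x\in(F,E)$ means $x\in F(e)$ for every $e\in E$; $x\notin(F,E)$ means $x\notin F(e)$ for some $e\in E$. Unions and intersections of soft sets are taken parameterwise. A soft topology on $X$ is a collection of soft sets containing the null soft set ($F(e)=\emptyset$ for all $e$) and the absolute soft set ($F(e)=X$ for all $e$), closed under pairwise intersections and arbitrary unions; its members are called soft open sets. The soft topology generated by $\boldsymbol{\Sigma}=\{\Sigma_e : e\in E\}$ is $\mathcal{T}(\boldsymbol{\Sigma})=\{(F,E)\in S_E(X) : F(e)\in\Sigma_e \text{ for all } e\in E\}$. A soft topology on $X$ is soft $T_1$ if for all $x,y\in X$ with $x\neq y$ there exist soft open sets $(U,E),(V,E)$ such that $x\in(U,E)$, $y\notin(U,E)$ and $x\notin(V,E)$, $y\in(V,E)$. *)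

theory Defs
  imports "HOL-Analysis.T1_Spaces" "HOL-Library.FuncSet"
begin

text \<open>
  A soft set \<open>(F,E) = {(e, F(e)) : e \<in> E}\<close> over \<open>X\<close> is the graph of a map \<open>F : E \<rightarrow> \<P>(X)\<close>.
  It is represented by the extensional function \<open>F\<close>, so that equality of soft sets is equality
  of graphs and values outside \<open>E\<close> carry no information.
\<close>

definition soft_sets :: "'a set \<Rightarrow> 'e set \<Rightarrow> ('e \<Rightarrow> 'a set) set" where
  "soft_sets X E = (E \<rightarrow>\<^sub>E Pow X)"

definition soft_mem :: "'e set \<Rightarrow> 'a \<Rightarrow> ('e \<Rightarrow> 'a set) \<Rightarrow> bool" where
  "soft_mem E x F \<longleftrightarrow> (\<forall>e\<in>E. x \<in> F e)"

text \<open>The relation \<open>x \<notin> (F,E)\<close> (some \<open>e \<in> E\<close> with \<open>x \<notin> F e\<close>) is the negation of \<open>soft_mem\<close>.\<close>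

definition soft_null :: "'e set \<Rightarrow> 'e \<Rightarrow> 'a set" where
  "soft_null E = (\<lambda>e\<in>E. {})"

definition soft_absolute :: "'a set \<Rightarrow> 'e set \<Rightarrow> 'e \<Rightarrow> 'a set" where
  "soft_absolute X E = (\<lambda>e\<in>E. X)"

definition soft_inter :: "'e set \<Rightarrow> ('e \<Rightarrow> 'a set) \<Rightarrow> ('e \<Rightarrow> 'a set) \<Rightarrow> 'e \<Rightarrow> 'a set" where
  "soft_inter E F G = (\<lambda>e\<in>E. F e \<inter> G e)"

definition soft_Union :: "'e set \<Rightarrow> ('e \<Rightarrow> 'a set) set \<Rightarrow> 'e \<Rightarrow> 'a set" where
  "soft_Union E \<F> = (\<lambda>e\<in>E. \<Union>F\<in>\<F>. F e)"

definition soft_topology :: "'a set \<Rightarrow> 'e set \<Rightarrow> ('e \<Rightarrow> 'a set) set \<Rightarrow> bool" where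
  "soft_topology X E \<T> \<longleftrightarrow>
     \<T> \<subseteq> soft_sets X E \<and>
     soft_null E \<in> \<T> \<and>
     soft_absolute X E \<in> \<T> \<and>
     (\<forall>F\<in>\<T>. \<forall>G\<in>\<T>. soft_inter E F G \<in> \<T>) \<and>
     (\<forall>\<F>. \<F> \<subseteq> \<T> \<longrightarrow> soft_Union E \<F> \<in> \<T>)"

definition generated_soft_topology ::
    "'a set \<Rightarrow> 'e set \<Rightarrow> ('e \<Rightarrow> 'a topology) \<Rightarrow> ('e \<Rightarrow> 'a set) set" where
  "generated_soft_topology X E \<Sigma> = {F \<in> soft_sets X E. \<forall>e\<in>E. openin (\<Sigma> e) (F e)}"

definition soft_T1_space :: "'a set \<Rightarrow> 'e set \<Rightarrow> ('e \<Rightarrow> 'a set) set \<Rightarrow> bool" where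
  "soft_T1_space X E \<T> \<longleftrightarrow>
     soft_topology X E \<T> \<and>
     (\<forall>x\<in>X. \<forall>y\<in>X. x \<noteq> y \<longrightarrow>
        (\<exists>U\<in>\<T>. \<exists>V\<in>\<T>.
           soft_mem E x U \<and> \<not> soft_mem E y U \<and> \<not> soft_mem E x V \<and> soft_mem E y V))"

end

theory Submission
  imports Defs
begin

text \<open>
  A set separating two points in the one \<open>T\<^sub>1\<close> coordinate \<open>e\<close> becomes a separating soft open set
  by taking the whole space in every other coordinate: soft non-membership needs to fail at one
  parameter only.
\<close>

text \<open>Soft operations and openness are both parameterwise, so each axiom reduces to the
  matching fact about \<open>\<Sigma> e\<close> at a fixed \<open>e\<close>. The common carrier
  \<open>X\<close> is what makes the absolute soft set a member.\<close>

lemma soft_topology_generated: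
  assumes "\<And>e. e \<in> E \<Longrightarrow> topspace (\<Sigma> e) = X"
  shows "soft_topology X E (generated_soft_topology X E \<Sigma>)"
proof -
  have full: "openin (\<Sigma> e) X" if "e \<in> E" for e
    using assms[OF that] openin_topspace by metis
  have Un: "soft_Union E \<F> \<in> generated_soft_topology X E \<Sigma>"
    if "\<F> \<subseteq> generated_soft_topology X E \<Sigma>" for \<F>
  proof -
    have "openin (\<Sigma> e) (\<Union>F\<in>\<F>. F e)" if "e \<in> E" for e
      using \<open>\<F> \<subseteq> _\<close> that by (intro openin_Union) (auto simp: generated_soft_topology_def)
    \<comment> \<open>Values must lie in \<open>Pow X\<close>; an open set of
      \<open>\<Sigma> e\<close> lies in its carrier, which is \<open>X\<close>.\<close>
    moreover have "(\<Union>F\<in>\<F>. F e) \<subseteq> X" if "e \<in> E" for e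
      using calculation[OF that] assms[OF that] openin_subset by metis
    ultimately show ?thesis
      by (auto simp: generated_soft_topology_def soft_sets_def soft_Union_def)
  qed
  have "soft_inter E F G \<in> generated_soft_topology X E \<Sigma>"
    if "F \<in> generated_soft_topology X E \<Sigma>" "G \<in> generated_soft_topology X E \<Sigma>" for F G
    using that by (auto simp: generated_soft_topology_def soft_sets_def soft_inter_def PiE_iff)
  moreover have "soft_null E \<in> generated_soft_topology X E \<Sigma>"
    by (auto simp: generated_soft_topology_def soft_sets_def soft_null_def)
  moreover have "soft_absolute X E \<in> generated_soft_topology X E \<Sigma>"
    using full by (auto simp: generated_soft_topology_def soft_sets_def soft_absolute_def)
  moreover have "generated_soft_topology X E \<Sigma> \<subseteq> soft_sets X E"
    by (auto simp: generated_soft_topology_def)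
  ultimately show ?thesis
    using Un unfolding soft_topology_def by blast
qed

text \<open>This is one half of the soft \<open>T\<^sub>1\<close> condition; its hypotheses are
  symmetric in \<open>x\<close> and \<open>y\<close>, so the other half follows by exchanging
  them.\<close>

lemma generated_soft_topology_separates:
  assumes top: "\<And>e. e \<in> E \<Longrightarrow> topspace (\<Sigma> e) = X"
    and e: "e \<in> E" "t1_space (\<Sigma> e)"
    and xy: "x \<in> X" "y \<in> X" "x \<noteq> y"
  shows "\<exists>U\<in>generated_soft_topology X E \<Sigma>. soft_mem E x U \<and> \<not> soft_mem E y U"
proof -
  obtain W where W: "openin (\<Sigma> e) W" "x \<in> W" "y \<notin> W"
    using e xy top[OF e(1)] by (auto simp: t1_space_def)
  \<comment> \<open>Restricting the function to \<open>E\<close> makes it extensional, as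
    \<open>soft_sets\<close> demands.\<close>
  define U where "U = (\<lambda>d\<in>E. if d = e then W else X)"
  have "W \<subseteq> X"
    using openin_subset[OF W(1)] top[OF e(1)] by simp
  moreover have "openin (\<Sigma> d) X" if "d \<in> E" for d
    using top[OF that] openin_topspace by metis
  ultimately have "U \<in> generated_soft_topology X E \<Sigma>"
    using W(1) by (auto simp: generated_soft_topology_def soft_sets_def U_def)
  \<comment> \<open>The point \<open>x\<close> lies in both possible values, \<open>W\<close> and
    \<open>X\<close>; \<open>y\<close> is missed at \<open>e\<close>, where the value is
    \<open>W\<close>.\<close>
  moreover have "soft_mem E x U" "\<not> soft_mem E y U"
    using W e(1) xy(1) by (auto simp: soft_mem_def U_def)
  ultimately show ?thesis by blast
qed

theorem theorem5p4:
  fixes X :: "'a set" and E :: "'e set" and \<Sigma> :: "'e \<Rightarrow> 'a topology"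
  assumes "\<And>e. e \<in> E \<Longrightarrow> topspace (\<Sigma> e) = X"
    and "\<exists>e\<in>E. t1_space (\<Sigma> e)"
  shows "soft_T1_space X E (generated_soft_topology X E \<Sigma>)"
proof -
  obtain e where e: "e \<in> E" "t1_space (\<Sigma> e)"
    using assms(2) by blast
  have sep: "\<exists>U\<in>generated_soft_topology X E \<Sigma>. soft_mem E x U \<and> \<not> soft_mem E y U"
    if "x \<in> X" "y \<in> X" "x \<noteq> y" for x y
    using assms(1) e that by (rule generated_soft_topology_separates)
  show ?thesis
    unfolding soft_T1_space_def
  proof (intro conjI ballI impI)
    show "soft_topology X E (generated_soft_topology X E \<Sigma>)"
      using assms(1) by (rule soft_topology_generated)
  next
    fix x y assume "x \<in> X" "y \<in> X" "x \<noteq> y"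
    then show "\<exists>U\<in>generated_soft_topology X E \<Sigma>. \<exists>V\<in>generated_soft_topology X E \<Sigma>.
        soft_mem E x U \<and> \<not> soft_mem E y U \<and> \<not> soft_mem E x V \<and> soft_mem E y V"
      \<comment> \<open>The first instance supplies \<open>U\<close>, the second, with the points
        exchanged, supplies \<open>V\<close>.\<close>
      using sep[of x y] sep[of y x] by blast
  qed
qed

end
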